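(* Assume that the two-stage stochastic mixed-integer problem defining $\zeta^{SIP}$ is feasible, that its optimal value is finite, and that the data defining it are rational. Let $m=n_x|S|$, let $N=\{\mathbf{n}_1,\dots,\mathbf{n}_l\}$ be a positive basis for $\mathbb{R}^m$, and let the augmenting function $\psi:\mathbb{R}^m\to\mathbb{R}$ be either $\psi(u)=\psi_\infty^N(u):=\max_{i=1,\dots,l}\{\mathbf{n}_i^\top u\}$ or $\psi(u)=\psi_1^N(u):=\sum_{i=1}^l\max\{\mathbf{n}_i^\top u,0\}$. Let $\omega_{LP}$ be an optimal multiplier of the non-anticipativity constraints in the linear programming relaxation. Then, with the penalty $\psi_\rho:=\rho\psi$, there exists a finite $\rho>0$ such that $$\zeta^{LD+}_\rho=\zeta^{LR+}_\rho(\omega_{LP})=\zeta^{SIP}.$$ In particular, this applies to the augmenting function $$\psi_\rho(u)=\sum_{s\in S}\underline{\rho}_s^\top[u_s]^-+\sum_{s\in S}\overline{\rho}_s^\top[-u_s]^-,\qquad u=(u_s)_{s\in S}\in\prod_{s\in S}\mathbb{R}^{n_x},$$ that is, there exists a finite $\rho=(\underline{\rho}_s,\overline{\rho}_s)_{s\in S}\in\mathbb{R}^{2n_x|S|}_{>0}$ for which the same equalities hold with this $\psi_\rho$.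
   Context: Problem. $S$ is a finite nonempty set of scenarios with probabilities $p_s>0$, $\sum_{s\in S}p_s=1$; $c\in\mathbb{R}^{n_x}$, $q_s\in\mathbb{R}^{n_y}$. The set $X\subset\mathbb{R}^{n_x}$ is defined by finitely many linear constraints and integrality restrictions on some components of $x$; for each $s$, $Y_s(x)\subset\mathbb{R}^{n_y}$ is the set of $y_s$ satisfying finitely many constraints linear in $(x,y_s)$ and integrality restrictions on some components of $y_s$. The problem is $$\zeta^{SIP}:=\min_{x,y}\Big\{c^\top x+\sum_{s\in S}p_s q_s^\top y_s:\ x\in X,\ y_s\in Y_s(x)\ \forall s\in S\Big\},$$ equivalently $$\zeta^{SIP}=\min_{x,y,z}\Big\{\sum_{s\in S}p_s(c^\top x_s+q_s^\top y_s):\ x_s-z=0,\ x_s\in X,\ y_s\in Y_s(x_s)\ \forall s\in S\Big\},$$ with $x_s,z\in\mathbb{R}^{n_x}$. The constraints $x_s-z=0$ ($s\in S$) are the non-anticipativity constraints. "Rational data" means $c$, $q_s$, $p_s$ and all coefficients and right-hand sides of the linear constraints defining $X$ and $Y_s(\cdot)$ are rational. Augmented Lagrangian. Let $L_s(x_s,y_s,z,\omega)=c^\top x_s+q_s^\top y_s+\omega_s^\top(x_s-z)$ and $\Omega=\{\omega=(\omega_s)_{s\in S}\in(\mathbb{R}^{n_x})^{S}:\sum_{s\in S}p_s\omega_s=0\}$. For a penalty function $\psi_\rho:\prod_{s\in S}\mathbb{R}^{n_x}\to\mathbb{R}$ depending on a parameter $\rho$, and $\omega\in\Omega$, $$\zeta^{LR+}_\rho(\omega):=\min_{x,y,z}\Big\{\sum_{s\in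 S}p_sL_s(x_s,y_s,z,\omega)+\psi_\rho\big((x_s-z)_{s\in S}\big):\ x_s\in X,\ y_s\in Y_s(x_s)\ \forall s\in S\Big\},$$ $z\in\mathbb{R}^{n_x}$ being free, and $\zeta^{LD+}_\rho:=\max_{\omega\in\Omega}\zeta^{LR+}_\rho(\omega)$. The multiplier $\omega_{LP}=(\lambda_s/p_s)_{s\in S}$, where $(\lambda_s)_{s\in S}$ is an optimal dual multiplier of the constraints $x_s-z=0$ in the linear programming relaxation (all integrality restrictions dropped) of the second formulation of $\zeta^{SIP}$. Notation. For a vector $v$, $[v]^-:=-\min\{0,v\}$ componentwise. A set $\{\mathbf{n}_1,\dots,\mathbf{n}_l\}\subset\mathbb{R}^m$ with $m+1\le l\le 2m$ is a positive basis for $\mathbb{R}^m$ iff every $u\in\mathbb{R}^m$ can be written $u=\sum_{i=1}^l\alpha_i\mathbf{n}_i$ with all $\alpha_i\ge0$. *)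

theory Defs
  imports "HOL-Analysis.Analysis"
begin

(* Scenarios are the elements of the finite type 's, so (R^nx)^S is (real^'nx)^'s and has
   dimension nx * |S|.  A pair (a, b) in Xcons stands for a . x <= b and a triple (d, e, f) in
   Ycons s for d . x + e . y <= f; an equation is given by two opposite inequalities.
   Xint and Yint s are the sets of components restricted to the integers. *)
record ('nx, 'ny, 's) smip =
  prob :: "'s \<Rightarrow> real"
  cost :: "real^'nx"
  recourse :: "'s \<Rightarrow> real^'ny"
  Xcons :: "((real^'nx) \<times> real) set"
  Xint :: "'nx set"
  Ycons :: "'s \<Rightarrow> ((real^'nx) \<times> (real^'ny) \<times> real) set"
  Yint :: "'s \<Rightarrow> 'ny set"

definition smip :: "('nx::finite, 'ny::finite, 's::finite) smip \<Rightarrow> bool" where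
  "smip P \<longleftrightarrow>
     (\<forall>s. 0 < prob P s) \<and> (\<Sum>s\<in>UNIV. prob P s) = 1 \<and>
     finite (Xcons P) \<and> (\<forall>s. finite (Ycons P s))"

definition rational_vec :: "real^'n \<Rightarrow> bool" where
  "rational_vec v \<longleftrightarrow> (\<forall>i. v $ i \<in> \<rat>)"

definition rational_data :: "('nx::finite, 'ny::finite, 's::finite) smip \<Rightarrow> bool" where
  "rational_data P \<longleftrightarrow>
     rational_vec (cost P) \<and>
     (\<forall>s. prob P s \<in> \<rat> \<and> rational_vec (recourse P s)) \<and>
     (\<forall>(a, b) \<in> Xcons P. rational_vec a \<and> b \<in> \<rat>) \<and>
     (\<forall>s. \<forall>(d, e, f) \<in> Ycons P s. rational_vec d \<and> rational_vec e \<and> f \<in> \<rat>)"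

definition X_relax :: "('nx::finite, 'ny::finite, 's::finite) smip \<Rightarrow> (real^'nx) set" where
  "X_relax P = {x. \<forall>(a, b) \<in> Xcons P. a \<bullet> x \<le> b}"

definition Y_relax ::
  "('nx::finite, 'ny::finite, 's::finite) smip \<Rightarrow> 's \<Rightarrow> real^'nx \<Rightarrow> (real^'ny) set" where
  "Y_relax P s x = {y. \<forall>(d, e, f) \<in> Ycons P s. d \<bullet> x + e \<bullet> y \<le> f}"

definition X_set :: "('nx::finite, 'ny::finite, 's::finite) smip \<Rightarrow> (real^'nx) set" where
  "X_set P = {x \<in> X_relax P. \<forall>i \<in> Xint P. x $ i \<in> \<int>}"

definition Y_set ::
  "('nx::finite, 'ny::finite, 's::finite) smip \<Rightarrow> 's \<Rightarrow> real^'nx \<Rightarrow> (real^'ny) set" where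
  "Y_set P s x = {y \<in> Y_relax P s x. \<forall>j \<in> Yint P s. y $ j \<in> \<int>}"

definition SIP_values :: "('nx::finite, 'ny::finite, 's::finite) smip \<Rightarrow> real set" where
  "SIP_values P =
     {cost P \<bullet> x + (\<Sum>s\<in>UNIV. prob P s * (recourse P s \<bullet> y $ s)) | x (y :: (real^'ny)^'s).
        x \<in> X_set P \<and> (\<forall>s. y $ s \<in> Y_set P s x)}"

(* Optimal values are infima and suprema in the extended reals; that they are attained is
   expressed separately. *)
definition zeta_SIP :: "('nx::finite, 'ny::finite, 's::finite) smip \<Rightarrow> ereal" where
  "zeta_SIP P = (INF v \<in> SIP_values P. ereal v)"

definition L_fun ::
  "('nx::finite, 'ny::finite, 's::finite) smip \<Rightarrow> 's \<Rightarrow>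
     real^'nx \<Rightarrow> real^'ny \<Rightarrow> real^'nx \<Rightarrow> (real^'nx)^'s \<Rightarrow> real" where
  "L_fun P s x y z \<omega> = cost P \<bullet> x + recourse P s \<bullet> y + \<omega> $ s \<bullet> (x - z)"

definition Omega :: "('nx::finite, 'ny::finite, 's::finite) smip \<Rightarrow> ((real^'nx)^'s) set" where
  "Omega P = {\<omega>. (\<Sum>s\<in>UNIV. prob P s *\<^sub>R \<omega> $ s) = 0}"

definition LR_values ::
  "('nx::finite, 'ny::finite, 's::finite) smip \<Rightarrow>
     ((real^'nx)^'s \<Rightarrow> real) \<Rightarrow> (real^'nx)^'s \<Rightarrow> real set" where
  "LR_values P \<psi> \<omega> =
     {(\<Sum>s\<in>UNIV. prob P s * L_fun P s (x $ s) (y $ s) z \<omega>) + \<psi> (\<chi> s. x $ s - z)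
        | (x :: (real^'nx)^'s) (y :: (real^'ny)^'s) z.
        \<forall>s. x $ s \<in> X_set P \<and> y $ s \<in> Y_set P s (x $ s)}"

definition zeta_LR ::
  "('nx::finite, 'ny::finite, 's::finite) smip \<Rightarrow>
     ((real^'nx)^'s \<Rightarrow> real) \<Rightarrow> (real^'nx)^'s \<Rightarrow> ereal" where
  "zeta_LR P \<psi> \<omega> = (INF v \<in> LR_values P \<psi> \<omega>. ereal v)"

definition zeta_LD ::
  "('nx::finite, 'ny::finite, 's::finite) smip \<Rightarrow> ((real^'nx)^'s \<Rightarrow> real) \<Rightarrow> ereal" where
  "zeta_LD P \<psi> = (SUP \<omega> \<in> Omega P. zeta_LR P \<psi> \<omega>)"

(* Linear programming dual of
     min  sum_s p_s (c . x_s + q_s . y_s)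
     s.t. x_s - z = 0              (multiplier lam_s, free)
          a . x_s <= b             (multiplier mu_s(a,b) >= 0)
          d . x_s + e . y_s <= f   (multiplier nu_s(d,e,f) >= 0)
   with x_s, y_s, z free.  The multipliers enter the Lagrangian with a plus sign, i.e. as
   lam_s . (x_s - z), in agreement with L_fun.  The conditions below are the stationarity of the
   Lagrangian in z, x_s and y_s, respectively. *)
definition LP_dual_feasible ::
  "('nx::finite, 'ny::finite, 's::finite) smip \<Rightarrow> (real^'nx)^'s \<Rightarrow>
     ('s \<Rightarrow> (real^'nx) \<times> real \<Rightarrow> real) \<Rightarrow> ('s \<Rightarrow> (real^'nx) \<times> (real^'ny) \<times> real \<Rightarrow> real) \<Rightarrow> bool" where
  "LP_dual_feasible P lam mu nu \<longleftrightarrow>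
     (\<forall>s. \<forall>k \<in> Xcons P. 0 \<le> mu s k) \<and>
     (\<forall>s. \<forall>k \<in> Ycons P s. 0 \<le> nu s k) \<and>
     (\<Sum>s\<in>UNIV. lam $ s) = 0 \<and>
     (\<forall>s. prob P s *\<^sub>R cost P + lam $ s + (\<Sum>(a, b) \<in> Xcons P. mu s (a, b) *\<^sub>R a)
            + (\<Sum>(d, e, f) \<in> Ycons P s. nu s (d, e, f) *\<^sub>R d) = 0) \<and>
     (\<forall>s. prob P s *\<^sub>R recourse P s + (\<Sum>(d, e, f) \<in> Ycons P s. nu s (d, e, f) *\<^sub>R e) = 0)"

definition LP_dual_objective ::
  "('nx::finite, 'ny::finite, 's::finite) smip \<Rightarrow>
     ('s \<Rightarrow> (real^'nx) \<times> real \<Rightarrow> real) \<Rightarrow> ('s \<Rightarrow> (real^'nx) \<times> (real^'ny) \<times> real \<Rightarrow> real) \<Rightarrow> real" where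
  "LP_dual_objective P mu nu =
     - (\<Sum>s\<in>UNIV. (\<Sum>(a, b) \<in> Xcons P. mu s (a, b) * b)
                   + (\<Sum>(d, e, f) \<in> Ycons P s. nu s (d, e, f) * f))"

definition optimal_LP_multiplier ::
  "('nx::finite, 'ny::finite, 's::finite) smip \<Rightarrow> (real^'nx)^'s \<Rightarrow> bool" where
  "optimal_LP_multiplier P lam \<longleftrightarrow>
     (\<exists>mu nu. LP_dual_feasible P lam mu nu \<and>
        (\<forall>lam' mu' nu'. LP_dual_feasible P lam' mu' nu' \<longrightarrow>
           LP_dual_objective P mu' nu' \<le> LP_dual_objective P mu nu))"

definition omega_LP ::
  "('nx::finite, 'ny::finite, 's::finite) smip \<Rightarrow> (real^'nx)^'s \<Rightarrow> (real^'nx)^'s" where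
  "omega_LP P lam = (\<chi> s. lam $ s /\<^sub>R prob P s)"

definition positive_basis :: "'a::euclidean_space set \<Rightarrow> bool" where
  "positive_basis N \<longleftrightarrow>
     finite N \<and> DIM('a) + 1 \<le> card N \<and> card N \<le> 2 * DIM('a) \<and>
     (\<forall>u. \<exists>\<alpha>. (\<forall>n\<in>N. 0 \<le> \<alpha> n) \<and> u = (\<Sum>n\<in>N. \<alpha> n *\<^sub>R n))"

definition psi_inf :: "'a::euclidean_space set \<Rightarrow> 'a \<Rightarrow> real" where
  "psi_inf N u = Max ((\<lambda>n. n \<bullet> u) ` N)"

definition psi_one :: "'a::euclidean_space set \<Rightarrow> 'a \<Rightarrow> real" where
  "psi_one N u = (\<Sum>n\<in>N. max (n \<bullet> u) 0)"

definition neg_part :: "real^'n \<Rightarrow> real^'n" where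
  "neg_part v = (\<chi> i. - min 0 (v $ i))"

definition asym_penalty ::
  "(real^'nx)^'s \<Rightarrow> (real^'nx)^'s \<Rightarrow> (real^'nx::finite)^'s::finite \<Rightarrow> real" where
  "asym_penalty \<rho>l \<rho>u u =
     (\<Sum>s\<in>UNIV. \<rho>l $ s \<bullet> neg_part (u $ s)) + (\<Sum>s\<in>UNIV. \<rho>u $ s \<bullet> neg_part (- u $ s))"

end

theory Submission
  imports Defs
begin

text \<open>Let \<open>v\<close> be the optimal value of the stochastic program. It is enough to show that every feasible
  point, with violation \<open>u = (x_s - z)\<close>, satisfies \<open>obj + \<lambda> \<bullet> u \<ge> v - R \<parallel>u\<parallel>\<close> for a constant \<open>R\<close>, because all the
  augmenting functions dominate a multiple of the norm. For large \<open>u\<close> this follows from linear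
  programming duality, which bounds the left-hand side from below.

  For small \<open>u\<close>, project the epigraph of the relaxation onto the integer variables \<open>k\<close>, the violation \<open>u\<close>
  and the objective bound \<open>t\<close>. By Fourier-Motzkin elimination the projection is given by finitely many
  rational inequalities \<open>G k + H u + \<sigma> t \<le> g\<close>, where \<open>\<sigma> \<le> 0\<close> since an epigraph is upward closed. As \<open>G k\<close>
  and \<open>g\<close> have a common denominator, the inequalities with \<open>\<sigma> = 0\<close> survive replacing a small \<open>u\<close> by \<open>0\<close>,
  and those with \<open>\<sigma> < 0\<close> survive if \<open>t\<close> is increased by a multiple of \<open>\<parallel>u\<parallel>\<close>. At \<open>u = 0\<close> the least \<open>t\<close>
  for given \<open>k\<close> is a rational number of bounded denominator, so the optimal value is attained.\<close>

section \<open>Projections of rational polyhedra\<close>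

text \<open>Points are functions on a finite index type rather than vectors, so that changing one
  coordinate is the function update \<open>w(j := r)\<close> used in elimination.\<close>

definition rat_polyhedron :: "('v::finite \<Rightarrow> real) set \<Rightarrow> bool" where
  "rat_polyhedron S \<longleftrightarrow> (\<exists>C. finite C \<and> (\<forall>(a, b)\<in>C. (\<forall>i. a i \<in> \<rat>) \<and> b \<in> \<rat>) \<and>
     S = {w. \<forall>(a, b)\<in>C. (\<Sum>i\<in>UNIV. a i * w i) \<le> b})"

definition rat_linear :: "(('v::finite \<Rightarrow> real) \<Rightarrow> real) \<Rightarrow> bool" where
  "rat_linear f \<longleftrightarrow> (\<exists>a. (\<forall>i. a i \<in> \<rat>) \<and> f = (\<lambda>w. \<Sum>i\<in>UNIV. a i * w i))"

lemma rat_linear_component: "rat_linear (\<lambda>w. w i)"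
proof -
  have "(\<Sum>j\<in>UNIV. (if j = i then 1 else 0) * w j) = w i" for w :: "'a \<Rightarrow> real"
    by (simp add: mult_delta_left)
  then show ?thesis
    unfolding rat_linear_def by (intro exI[of _ "\<lambda>j. if j = i then 1 else 0"]) simp
qed

lemma rat_linear_scale:
  assumes "rat_linear f" and "q \<in> \<rat>"
  shows "rat_linear (\<lambda>w. q * f w)"
proof -
  obtain a where a: "\<And>i. a i \<in> \<rat>" and f: "f = (\<lambda>w. \<Sum>i\<in>UNIV. a i * w i)"
    using assms by (auto simp: rat_linear_def)
  show ?thesis
    unfolding rat_linear_def
    by (intro exI[of _ "\<lambda>i. q * a i"]) (auto simp: f a assms sum_distrib_left mult.assoc)
qed

lemma rat_linear_add:
  assumes "rat_linear f" and "rat_linear g"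
  shows "rat_linear (\<lambda>w. f w + g w)"
proof -
  obtain a where a: "\<And>i. a i \<in> \<rat>" and f: "f = (\<lambda>w. \<Sum>i\<in>UNIV. a i * w i)"
    using assms by (auto simp: rat_linear_def)
  obtain b where b: "\<And>i. b i \<in> \<rat>" and g: "g = (\<lambda>w. \<Sum>i\<in>UNIV. b i * w i)"
    using assms by (auto simp: rat_linear_def)
  show ?thesis
    unfolding rat_linear_def
    by (intro exI[of _ "\<lambda>i. a i + b i"]) (auto simp: f g a b sum.distrib distrib_right)
qed

lemma rat_linear_diff:
  assumes "rat_linear f" and "rat_linear g"
  shows "rat_linear (\<lambda>w. f w - g w)"
  using rat_linear_add[OF assms(1) rat_linear_scale[OF assms(2), of "-1"]] by simp

lemma rat_linear_sum:
  assumes "finite A" and "\<And>k. k \<in> A \<Longrightarrow> rat_linear (f k)"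
  shows "rat_linear (\<lambda>w. \<Sum>k\<in>A. f k w)"
  using assms
proof (induction A)
  case empty
  show ?case by (auto simp: rat_linear_def intro!: exI[of _ "\<lambda>_. 0"])
next
  case (insert k A)
  then show ?case by (simp add: rat_linear_add)
qed

text \<open>\<open>g\<close> selects the block of flat coordinates that holds one vector, for
  example \<open>VX s\<close> for the first-stage copy of scenario \<open>s\<close>.\<close>

lemma rat_linear_inner:
  assumes "rational_vec a"
  shows "rat_linear (\<lambda>w. a \<bullet> (\<chi> i. w (g i)))"
proof -
  have "rat_linear (\<lambda>w. \<Sum>i\<in>UNIV. a $ i * w (g i))"
  proof (rule rat_linear_sum)
    show "rat_linear (\<lambda>w. a $ i * w (g i))" for i
      using assms by (intro rat_linear_scale rat_linear_component) (simp add: rational_vec_def)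
  qed simp
  then show ?thesis by (simp add: inner_vec_def)
qed

lemma rat_polyhedron_halfspace:
  assumes "rat_linear f" and "b \<in> \<rat>"
  shows "rat_polyhedron {w. f w \<le> b}"
proof -
  obtain a where a: "\<And>i. a i \<in> \<rat>" and f: "f = (\<lambda>w. \<Sum>i\<in>UNIV. a i * w i)"
    using assms by (auto simp: rat_linear_def)
  show ?thesis
    unfolding rat_polyhedron_def by (intro exI[of _ "{(a, b)}"]) (auto simp: a f assms)
qed

lemma rat_polyhedron_Int:
  assumes "rat_polyhedron S" and "rat_polyhedron T"
  shows "rat_polyhedron (S \<inter> T)"
proof -
  obtain C where "finite C" "\<forall>(a, b)\<in>C. (\<forall>i. a i \<in> \<rat>) \<and> b \<in> \<rat>"
    "S = {w. \<forall>(a, b)\<in>C. (\<Sum>i\<in>UNIV. a i * w i) \<le> b}"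
    using assms by (auto simp: rat_polyhedron_def)
  moreover obtain D where "finite D" "\<forall>(a, b)\<in>D. (\<forall>i. a i \<in> \<rat>) \<and> b \<in> \<rat>"
    "T = {w. \<forall>(a, b)\<in>D. (\<Sum>i\<in>UNIV. a i * w i) \<le> b}"
    using assms by (auto simp: rat_polyhedron_def)
  ultimately show ?thesis
    unfolding rat_polyhedron_def by (intro exI[of _ "C \<union> D"]) auto
qed

lemma rat_polyhedron_Ball:
  assumes "finite A" and "\<And>k. k \<in> A \<Longrightarrow> rat_polyhedron {w. p k w}"
  shows "rat_polyhedron {w. \<forall>k\<in>A. p k w}"
  using assms
proof (induction A)
  case empty
  show ?case by (auto simp: rat_polyhedron_def intro!: exI[of _ "{}"])
next
  case (insert k A)
  have "{w. \<forall>k\<in>insert k A. p k w} = {w. p k w} \<inter> {w. \<forall>k\<in>A. p k w}" by auto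
  then show ?case using insert by (simp add: rat_polyhedron_Int)
qed

lemma rat_polyhedron_All:
  fixes p :: "'k::finite \<Rightarrow> _"
  assumes "\<And>k. rat_polyhedron {w. p k w}"
  shows "rat_polyhedron {w. \<forall>k. p k w}"
proof -
  have "rat_polyhedron {w. \<forall>k\<in>UNIV. p k w}"
    by (rule rat_polyhedron_Ball) (use assms in auto)
  then show ?thesis by simp
qed

section \<open>Fourier-Motzkin elimination and common denominators\<close>

lemma finite_separation:
  fixes L U :: "real set"
  assumes "finite L" "finite U" "\<And>l u. l \<in> L \<Longrightarrow> u \<in> U \<Longrightarrow> l \<le> u"
  obtains r where "\<And>l. l \<in> L \<Longrightarrow> l \<le> r" "\<And>u. u \<in> U \<Longrightarrow> r \<le> u"
proof (cases "L = {}")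
  case True
  show ?thesis
  proof (cases "U = {}")
    case False
    with True show ?thesis using that[of "Min U"] assms by auto
  qed (use True that in auto)
next
  case False
  then show ?thesis using that[of "Max L"] assms by auto
qed

text \<open>Rows with a positive coefficient at \<open>j\<close> bound \<open>r\<close> from above,
  those with a negative one from below. A suitable \<open>r\<close> exists exactly when every lower
  bound is at most every upper bound, and each such comparison is again a rational
  inequality.\<close>

lemma rat_polyhedron_eliminate:
  assumes "rat_polyhedron S"
  shows "rat_polyhedron {w. \<exists>r. w(j := r) \<in> S}"
proof -
  obtain C where fin: "finite C" and rat: "\<And>c. c \<in> C \<Longrightarrow> (\<forall>i. fst c i \<in> \<rat>) \<and> snd c \<in> \<rat>"
    and S: "S = {w. \<forall>c\<in>C. (\<Sum>i\<in>UNIV. fst c i * w i) \<le> snd c}"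
    using assms unfolding rat_polyhedron_def case_prod_beta by blast
  \<comment> \<open>Row \<open>n\<close> times \<open>fst p j\<close> plus row \<open>p\<close>
    times \<open>- fst n j\<close>. For \<open>p\<close> in \<open>Pos\<close> and \<open>n\<close>
    in \<open>Neg\<close> both factors are positive, and the coefficient at \<open>j\<close>
    cancels.\<close>
  define comb :: "('a \<Rightarrow> real) \<times> real \<Rightarrow> ('a \<Rightarrow> real) \<times> real \<Rightarrow> ('a \<Rightarrow> real) \<times> real" where
    "comb p n = (\<lambda>i. fst p j * fst n i - fst n j * fst p i, fst p j * snd n - fst n j * snd p)" for p n
  define Z where "Z = {c\<in>C. fst c j = 0}"
  define Pos where "Pos = {c\<in>C. fst c j > 0}"
  define Neg where "Neg = {c\<in>C. fst c j < 0}"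
  define D where "D = Z \<union> (\<lambda>(p, n). comb p n) ` (Pos \<times> Neg)"
  define rest where "rest a w = (\<Sum>i\<in>-{j}. a i * w i)" for a w :: "'a \<Rightarrow> real"
  have split: "(\<Sum>i\<in>UNIV. a i * w i) = a j * w j + rest a w" for a w
    unfolding rest_def Compl_eq_Diff_UNIV by (rule sum.remove) auto
  have rest_upd: "rest a (w(j := r)) = rest a w" for a w r
    unfolding rest_def by (rule sum.cong) auto
  have mem_S: "w(j := r) \<in> S \<longleftrightarrow> (\<forall>c\<in>C. fst c j * r + rest (fst c) w \<le> snd c)" for w r
    unfolding S mem_Collect_eq split rest_upd fun_upd_same ..
  have rest_comb: "rest (fst (comb p n)) w = fst p j * rest (fst n) w - fst n j * rest (fst p) w" for p n w
    unfolding rest_def comb_def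
    by (simp add: left_diff_distrib sum_subtractf sum_distrib_left mult.assoc)
  have row_comb: "(\<Sum>i\<in>UNIV. fst (comb p n) i * w i) = fst p j * rest (fst n) w - fst n j * rest (fst p) w"
    for p n w
    unfolding split rest_comb by (simp add: comb_def)
  have iff: "(\<exists>r. w(j := r) \<in> S) \<longleftrightarrow> (\<forall>c\<in>D. (\<Sum>i\<in>UNIV. fst c i * w i) \<le> snd c)" for w
  proof
    assume "\<exists>r. w(j := r) \<in> S"
    then obtain r where r: "\<And>c. c \<in> C \<Longrightarrow> fst c j * r + rest (fst c) w \<le> snd c"
      unfolding mem_S by blast
    show "\<forall>c\<in>D. (\<Sum>i\<in>UNIV. fst c i * w i) \<le> snd c"
    proof
      fix c assume "c \<in> D"
      then consider "c \<in> Z" | p n where "p \<in> Pos" "n \<in> Neg" "c = comb p n"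
        by (auto simp: D_def)
      then show "(\<Sum>i\<in>UNIV. fst c i * w i) \<le> snd c"
      proof cases
        case 1
        then show ?thesis using r[of c] unfolding split by (simp add: Z_def)
      next
        case 2
        have "fst p j * (fst n j * r + rest (fst n) w) \<le> fst p j * snd n"
          using 2 r by (intro mult_left_mono) (auto simp: Pos_def Neg_def)
        moreover have "- fst n j * (fst p j * r + rest (fst p) w) \<le> - fst n j * snd p"
          using 2 r by (intro mult_left_mono) (auto simp: Pos_def Neg_def)
        ultimately show ?thesis
          unfolding 2(3) row_comb by (simp add: comb_def algebra_simps)
      qed
    qed
  next
    assume D: "\<forall>c\<in>D. (\<Sum>i\<in>UNIV. fst c i * w i) \<le> snd c"
    \<comment> \<open>The row \<open>c\<close> solved for \<open>r\<close>: an upper bound on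
      \<open>Pos\<close>, and a lower bound on \<open>Neg\<close>, where the division reverses the
      inequality.\<close>
    define bnd where "bnd c = (snd c - rest (fst c) w) / fst c j" for c
    have le: "bnd n \<le> bnd p" if "p \<in> Pos" "n \<in> Neg" for p n
    proof -
      have "comb p n \<in> D" using that by (auto simp: D_def)
      with D have "(\<Sum>i\<in>UNIV. fst (comb p n) i * w i) \<le> snd (comb p n)" by blast
      then have "fst p j * rest (fst n) w - fst n j * rest (fst p) w \<le> fst p j * snd n - fst n j * snd p"
        unfolding row_comb by (simp add: comb_def)
      moreover have "fst p j > 0" "fst n j < 0" using that by (auto simp: Pos_def Neg_def)
      ultimately show ?thesis by (simp add: bnd_def field_simps)
    qed
    have "finite (bnd ` Neg)" "finite (bnd ` Pos)" using fin by (simp_all add: Neg_def Pos_def)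
    then obtain r where r: "\<And>l. l \<in> bnd ` Neg \<Longrightarrow> l \<le> r" "\<And>u. u \<in> bnd ` Pos \<Longrightarrow> r \<le> u"
      by (rule finite_separation) (use le in blast)+
    have "fst c j * r + rest (fst c) w \<le> snd c" if c: "c \<in> C" for c
    proof -
      consider "fst c j = 0" | "fst c j > 0" | "fst c j < 0" by linarith
      then show ?thesis
      proof cases
        case 1
        then have "c \<in> D" using c by (auto simp: D_def Z_def)
        with D have "(\<Sum>i\<in>UNIV. fst c i * w i) \<le> snd c" by blast
        then show ?thesis using 1 unfolding split by simp
      next
        case 2
        then have "r \<le> bnd c" using r(2) c by (simp add: Pos_def)
        then show ?thesis using 2 by (simp add: bnd_def field_simps)
      next
        case 3
        then have "bnd c \<le> r" using r(1) c by (simp add: Neg_def)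
        then show ?thesis using 3 by (simp add: bnd_def field_simps)
      qed
    qed
    then show "\<exists>r. w(j := r) \<in> S" unfolding mem_S by blast
  qed
  have "finite D" using fin by (auto simp: D_def Z_def Pos_def Neg_def)
  moreover have "\<forall>c\<in>D. (\<forall>i. fst c i \<in> \<rat>) \<and> snd c \<in> \<rat>"
    using rat by (auto simp: D_def comb_def Z_def Pos_def Neg_def)
  ultimately show ?thesis
    unfolding rat_polyhedron_def case_prod_beta by (intro exI[of _ D] conjI Collect_cong iff)
qed

text \<open>The projection is kept as a cylinder whose points are arbitrary on \<open>J\<close>. The
  index type therefore never changes, and induction on \<open>J\<close> eliminates one coordinate at
  a time.\<close>

lemma rat_polyhedron_projection:
  fixes S :: "('v::finite \<Rightarrow> real) set"
  assumes "rat_polyhedron S"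
  shows "rat_polyhedron {w. \<exists>w'\<in>S. \<forall>i. i \<notin> J \<longrightarrow> w' i = w i}"
proof -
  have "finite J" by simp
  then show ?thesis
  proof (induction J)
    case empty
    have "{w. \<exists>w'\<in>S. \<forall>i. i \<notin> {} \<longrightarrow> w' i = w i} = S" by (auto simp: fun_eq_iff[symmetric])
    then show ?case using assms by simp
  next
    case (insert j J)
    have "{w. \<exists>w'\<in>S. \<forall>i. i \<notin> insert j J \<longrightarrow> w' i = w i} =
      {w. \<exists>r. w(j := r) \<in> {w. \<exists>w'\<in>S. \<forall>i. i \<notin> J \<longrightarrow> w' i = w i}}" (is "?A = ?B")
    proof
      show "?A \<subseteq> ?B"
      proof
        fix w assume "w \<in> ?A"
        then obtain w' where "w' \<in> S" "\<forall>i. i \<notin> insert j J \<longrightarrow> w' i = w i" by blast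
        then show "w \<in> ?B" by (auto intro!: exI[of _ "w' j"] bexI[of _ w'])
      qed
      show "?B \<subseteq> ?A" using insert.hyps by (auto split: if_splits)
    qed
    then show ?case using rat_polyhedron_eliminate[OF insert.IH] by simp
  qed
qed

lemma common_denominator:
  fixes R :: "real set"
  assumes "finite R" "R \<subseteq> \<rat>"
  obtains N :: nat where "N > 0" "\<And>r. r \<in> R \<Longrightarrow> real N * r \<in> \<int>"
proof -
  have "\<exists>N::nat. N > 0 \<and> (\<forall>r\<in>R. real N * r \<in> \<int>)"
    using assms
  proof (induction R)
    case empty
    show ?case by (auto intro!: exI[of _ 1])
  next
    case (insert r R)
    then obtain N :: nat where N: "N > 0" "\<forall>r\<in>R. real N * r \<in> \<int>" by auto
    obtain m n where n: "n > 0" "r = real_of_int m / real_of_int n"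
      using insert.prems by (auto elim: Rats_cases')
    have "real (N * nat n) * r = real_of_int (int N * m)"
      using n by simp
    moreover have "real (N * nat n) * r' = of_int n * (real N * r')" for r'
      using n by simp
    ultimately have "\<forall>r'\<in>insert r R. real (N * nat n) * r' \<in> \<int>"
      using N by (metis Ints_mult Ints_of_int insert_iff)
    then show ?case using N n by (intro exI[of _ "N * nat n"]) auto
  qed
  then show ?thesis using that by blast
qed

section \<open>Mixed-integer programs under small perturbations\<close>

text \<open>Rounding reduces the minimization to values in (1/N) times the integers, and a nonempty
  set of such values that is bounded below has a least element.\<close>

lemma arg_min_discrete:
  fixes f :: "'a \<Rightarrow> real" and N :: nat
  assumes "F \<noteq> {}" and "N > 0"
    and below: "\<And>w. w \<in> F \<Longrightarrow> l \<le> f w"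
    and round: "\<And>w. w \<in> F \<Longrightarrow> \<exists>w'\<in>F. f w' \<le> f w \<and> real N * f w' \<in> \<int>"
  obtains w where "w \<in> F" and "\<And>w'. w' \<in> F \<Longrightarrow> f w \<le> f w'"
proof -
  define G where "G = {w\<in>F. real N * f w \<in> \<int>}"
  define lo where "lo = \<lfloor>real N * l\<rfloor>"
  \<comment> \<open>On \<open>G\<close> this counts the steps of size 1/N above a fixed lower bound,
    so the least-number principle for naturals applies.\<close>
  define m where "m w = nat (\<lfloor>real N * f w\<rfloor> - lo)" for w
  have "G \<noteq> {}" using assms by (auto simp: G_def)
  then obtain w where w: "w \<in> G" and min: "\<And>w'. w' \<in> G \<Longrightarrow> m w \<le> m w'"
    using ex_has_least_nat[of "\<lambda>w. w \<in> G" _ m] by blast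
  have m: "real (m w) = real N * f w - lo" if "w \<in> G" for w
  proof -
    have "lo \<le> \<lfloor>real N * f w\<rfloor>"
      unfolding lo_def using that below \<open>N > 0\<close> by (intro floor_mono mult_left_mono) (auto simp: G_def)
    moreover have "of_int \<lfloor>real N * f w\<rfloor> = real N * f w" using that by (auto simp: G_def elim: Ints_cases)
    ultimately show ?thesis by (simp add: m_def)
  qed
  have le: "f w \<le> f w'" if "w' \<in> G" for w'
  proof -
    have "real (m w) \<le> real (m w')" using min[OF that] by simp
    then have "real N * f w \<le> real N * f w'" unfolding m[OF w] m[OF that] by simp
    then show ?thesis using \<open>N > 0\<close> by simp
  qed
  show ?thesis
  proof
    show "w \<in> F" using w by (simp add: G_def)
    fix w' assume "w' \<in> F"
    then obtain w'' where "w'' \<in> G" "f w'' \<le> f w'" using round by (force simp: G_def)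
    then show "f w \<le> f w'" using le by fastforce
  qed
qed

text \<open>\<open>I\<close> holds the integer coordinates, \<open>U\<close> the perturbed ones and
  \<open>\<tau>\<close> the objective bound; all others are projected away. A point with a small
  perturbation is turned into an unperturbed one by zeroing \<open>U\<close> and raising
  \<open>\<tau>\<close> in proportion to \<open>d\<close>; comparing it with the minimizer
  \<open>w0\<close> gives the estimate.\<close>

lemma mixed_integer_exactness:
  fixes S :: "('v::finite \<Rightarrow> real) set" and I U :: "'v set" and \<tau> :: 'v
  defines "F \<equiv> {w\<in>S. (\<forall>i\<in>I. w i \<in> \<int>) \<and> (\<forall>i\<in>U. w i = 0)}"
  assumes poly: "rat_polyhedron S"
    and \<tau>: "\<tau> \<notin> I" "\<tau> \<notin> U"
    and up: "\<forall>w\<in>S. \<forall>r\<ge>0. w(\<tau> := w \<tau> + r) \<in> S"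
    and "F \<noteq> {}" and below: "\<forall>w\<in>F. l \<le> w \<tau>"
  obtains w0 \<delta> K where "w0 \<in> F" "\<And>w. w \<in> F \<Longrightarrow> w0 \<tau> \<le> w \<tau>" "0 < \<delta>" "0 \<le> K"
    "\<And>w d. w \<in> S \<Longrightarrow> 0 \<le> d \<Longrightarrow> \<forall>i\<in>I. w i \<in> \<int> \<Longrightarrow> \<forall>i\<in>U. \<bar>w i\<bar> \<le> d \<Longrightarrow> d \<le> \<delta> \<Longrightarrow> w0 \<tau> - K * d \<le> w \<tau>"
proof -
  define J where "J = - (I \<union> U \<union> {\<tau>})"
  define S' where "S' = {w. \<exists>w'\<in>S. \<forall>i. i \<notin> J \<longrightarrow> w' i = w i}"
  have "rat_polyhedron S'" unfolding S'_def by (rule rat_polyhedron_projection[OF poly])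
  then obtain C where fin: "finite C" and rat: "\<And>c. c \<in> C \<Longrightarrow> (\<forall>i. fst c i \<in> \<rat>) \<and> snd c \<in> \<rat>"
    and S': "S' = {w. \<forall>c\<in>C. (\<Sum>i\<in>UNIV. fst c i * w i) \<le> snd c}"
    unfolding rat_polyhedron_def case_prod_beta by blast
  define rest where "rest c w = (\<Sum>i\<in>-{\<tau>}. fst c i * w i)" for c :: "('v \<Rightarrow> real) \<times> real" and w
  \<comment> \<open>\<open>bar\<close> removes the perturbation. It also zeroes \<open>J\<close>,
    where points of the cylinder \<open>S'\<close> are arbitrary, so that all coordinates except
    \<open>\<tau>\<close> are integers whenever \<open>w\<close> is integral on
    \<open>I\<close>.\<close>
  define bar where "bar w = (\<lambda>i. if i = \<tau> \<or> (i \<in> I \<and> i \<notin> U) then w i else 0)" for w :: "'v \<Rightarrow> real"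
  have split: "(\<Sum>i\<in>UNIV. fst c i * w i) = fst c \<tau> * w \<tau> + rest c w" for c w
    unfolding rest_def Compl_eq_Diff_UNIV by (rule sum.remove) auto
  have rest_upd: "rest c (w(\<tau> := t)) = rest c w" for c w t
    unfolding rest_def by (rule sum.cong) auto
  have mem_S': "w(\<tau> := t) \<in> S' \<longleftrightarrow> (\<forall>c\<in>C. fst c \<tau> * t + rest c w \<le> snd c)" for w t
    unfolding S' mem_Collect_eq split rest_upd fun_upd_same ..
  have row: "fst c \<tau> * w \<tau> + rest c w \<le> snd c" if "w \<in> S'" "c \<in> C" for w c
    using that unfolding S' split by blast

  \<comment> \<open>The quotients make \<open>N\<close> also clear the denominators of the bounds on
    \<open>\<tau>\<close>. For \<open>fst c \<tau> = 0\<close> they are 0 by the convention for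
    division and do no harm.\<close>
  define R where "R = (\<Union>c\<in>C. range (fst c)) \<union> snd ` C \<union>
    (\<Union>c\<in>C. range (\<lambda>i. fst c i / fst c \<tau>)) \<union> (\<lambda>c. snd c / fst c \<tau>) ` C"
  have "finite R" "R \<subseteq> \<rat>" using fin rat by (auto simp: R_def)
  then obtain N :: nat where N: "N > 0" "\<And>r. r \<in> R \<Longrightarrow> real N * r \<in> \<int>"
    by (rule common_denominator) blast
  have Na: "real N * fst c i \<in> \<int>" and Nb: "real N * snd c \<in> \<int>"
    and Na': "real N * (fst c i / fst c \<tau>) \<in> \<int>" and Nb': "real N * (snd c / fst c \<tau>) \<in> \<int>"
    if "c \<in> C" for c i
    by (rule N(2), use that in \<open>unfold R_def, blast\<close>)+

  have bar_int: "bar w i \<in> \<int>" if "\<forall>i\<in>I. w i \<in> \<int>" "i \<noteq> \<tau>" for w i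
    using that by (auto simp: bar_def)

  \<comment> \<open>This undoes the projection: the coordinates in \<open>J\<close> are recovered
    from \<open>S\<close>, and the result is in \<open>F\<close> because \<open>bar w\<close> is 0
    on \<open>U\<close> and integral on \<open>I\<close>.\<close>
  have lift: "\<exists>w'\<in>F. w' \<tau> = t" if "(bar w)(\<tau> := t) \<in> S'" "\<forall>i\<in>I. w i \<in> \<int>" for w t
  proof -
    obtain w' where w': "w' \<in> S" "\<And>i. i \<notin> J \<Longrightarrow> w' i = ((bar w)(\<tau> := t)) i"
      using \<open>(bar w)(\<tau> := t) \<in> S'\<close> unfolding S'_def by blast
    have "w' i = (if i = \<tau> then t else bar w i)" if "i \<in> I \<union> U \<union> {\<tau>}" for i
      using that by (subst w') (auto simp: J_def)
    then have "w' \<in> F" "w' \<tau> = t"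
      using w'(1) \<tau> that(2) by (auto simp: F_def bar_def)
    then show ?thesis by blast
  qed

  have zeroed: "(\<lambda>i. if i \<in> J then 0 else w i) \<in> S'" if "w \<in> S" for w
    using that unfolding S'_def by auto

  have F_int: "\<forall>i\<in>I. w i \<in> \<int>" if "w \<in> F" for w
    using that by (simp add: F_def)

  have F_bar: "bar w \<in> S'" if "w \<in> F" for w
  proof -
    have "bar w = (\<lambda>i. if i \<in> J then 0 else w i)"
      using that by (auto simp: F_def bar_def J_def)
    then show ?thesis using zeroed that by (simp add: F_def)
  qed

  obtain w00 where w00: "w00 \<in> F" using \<open>F \<noteq> {}\<close> by blast
  have nonpos: "fst c \<tau> \<le> 0" if c: "c \<in> C" for c
  proof (rule ccontr)
    assume pos: "\<not> fst c \<tau> \<le> 0"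
    \<comment> \<open>The shift moves \<open>\<tau>\<close> beyond the largest value that row
      \<open>c\<close> would allow; \<open>up\<close> permits it because it is nonnegative.\<close>
    define r where "r = max 0 ((snd c - rest c (\<lambda>i. if i \<in> J then 0 else w00 i)) / fst c \<tau> - w00 \<tau> + 1)"
    have "w00(\<tau> := w00 \<tau> + r) \<in> S" using up w00 by (auto simp: F_def r_def)
    then have "(\<lambda>i. if i \<in> J then 0 else (w00(\<tau> := w00 \<tau> + r)) i) \<in> S'" by (rule zeroed)
    moreover have "(\<lambda>i. if i \<in> J then 0 else (w00(\<tau> := w00 \<tau> + r)) i) =
      (\<lambda>i. if i \<in> J then 0 else w00 i)(\<tau> := w00 \<tau> + r)" by (auto simp: J_def)
    ultimately have le: "fst c \<tau> * (w00 \<tau> + r) + rest c (\<lambda>i. if i \<in> J then 0 else w00 i) \<le> snd c"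
      using c unfolding mem_S'[symmetric] by (simp add: mem_S')
    have "(snd c - rest c (\<lambda>i. if i \<in> J then 0 else w00 i)) / fst c \<tau> < w00 \<tau> + r"
      by (auto simp: r_def)
    then show False using le pos by (simp add: field_simps)
  qed

  define Neg where "Neg = {c\<in>C. fst c \<tau> < 0}"
  \<comment> \<open>Otherwise no row would involve \<open>\<tau>\<close>, which could then be
    lowered to \<open>l - 1\<close>, against the lower bound on \<open>F\<close>.\<close>
  have "Neg \<noteq> {}"
  proof
    assume "Neg = {}"
    then have zero: "fst c \<tau> = 0" if "c \<in> C" for c
    proof -
      have "\<not> fst c \<tau> < 0" using that \<open>Neg = {}\<close> unfolding Neg_def by blast
      then show ?thesis using nonpos[OF that] by simp
    qed
    have "(bar w00)(\<tau> := l - 1) \<in> S'"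
      unfolding mem_S' using row[OF F_bar[OF w00]] zero by simp
    then obtain w' where "w' \<in> F" "w' \<tau> = l - 1" using lift F_int[OF w00] by blast
    then show False using below by force
  qed

  have round: "\<exists>w'\<in>F. w' \<tau> \<le> w \<tau> \<and> real N * w' \<tau> \<in> \<int>" if w: "w \<in> F" for w
  proof -
    define bnd where "bnd c = (snd c - rest c (bar w)) / fst c \<tau>" for c
    \<comment> \<open>The least value of \<open>\<tau>\<close> that the rows allow for the integer
      part of \<open>w\<close>. The maximum is attained, so \<open>t\<close> is some
      \<open>bnd c\<close>, and N times it is an integer.\<close>
    define t where "t = Max (bnd ` Neg)"
    have finNeg: "finite (bnd ` Neg)" using fin by (simp add: Neg_def)
    have bar_\<tau>: "bar w \<tau> = w \<tau>" by (simp add: bar_def)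
    have r: "fst c \<tau> * w \<tau> + rest c (bar w) \<le> snd c" if "c \<in> C" for c
      using row[OF F_bar[OF w] that] by (simp add: bar_\<tau>)
    have "bnd c \<le> w \<tau>" if "c \<in> Neg" for c
      using r[of c] that by (simp add: Neg_def bnd_def field_simps)
    then have le: "t \<le> w \<tau>"
      unfolding t_def using finNeg \<open>Neg \<noteq> {}\<close> by (subst Max_le_iff) auto
    have "fst c \<tau> * t + rest c (bar w) \<le> snd c" if c: "c \<in> C" for c
    proof (cases "fst c \<tau> = 0")
      case True
      then show ?thesis using r[OF c] by simp
    next
      case False
      then have neg: "fst c \<tau> < 0" using nonpos[OF c] by simp
      then have "bnd c \<le> t" unfolding t_def using c finNeg by (intro Max_ge) (auto simp: Neg_def)
      then show ?thesis using neg by (simp add: bnd_def field_simps)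
    qed
    then have "(bar w)(\<tau> := t) \<in> S'" unfolding mem_S' by blast
    then obtain w' where w': "w' \<in> F" "w' \<tau> = t" using lift F_int[OF w] by blast
    have "t \<in> bnd ` Neg" unfolding t_def using finNeg \<open>Neg \<noteq> {}\<close> by (intro Max_in) auto
    then obtain c where c: "c \<in> C" "t = bnd c" by (auto simp: Neg_def)
    have "real N * t = real N * (snd c / fst c \<tau>) - (\<Sum>i\<in>-{\<tau>}. real N * (fst c i / fst c \<tau>) * bar w i)"
      by (simp add: c bnd_def rest_def diff_divide_distrib right_diff_distrib sum_distrib_left sum_divide_distrib mult.assoc)
    also have "\<dots> \<in> \<int>"
      by (intro Ints_diff Nb'[OF c(1)] Ints_sum Ints_mult[OF Na'[OF c(1)]] bar_int[OF F_int[OF w]]) simp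
    finally show ?thesis using w' le by auto
  qed

  obtain w0 where w0: "w0 \<in> F" "\<And>w. w \<in> F \<Longrightarrow> w0 \<tau> \<le> w \<tau>"
    using arg_min_discrete[of F N l "\<lambda>w. w \<tau>"] \<open>F \<noteq> {}\<close> N(1) below round by blast

  \<comment> \<open>A common bound for the absolute coefficient sums of all rows; the summand 1
    makes it positive, so that the radius below may divide by it.\<close>
  define A where "A = 1 + (\<Sum>c\<in>C. \<Sum>i\<in>UNIV. \<bar>fst c i\<bar>)"
  have A1: "A \<ge> 1" by (simp add: A_def sum_nonneg)
  have A: "(\<Sum>i\<in>-{\<tau>}. \<bar>fst c i\<bar>) \<le> A" if "c \<in> C" for c
  proof -
    have "(\<Sum>i\<in>-{\<tau>}. \<bar>fst c i\<bar>) \<le> (\<Sum>i\<in>UNIV. \<bar>fst c i\<bar>)" by (rule sum_mono2) auto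
    also have "\<dots> \<le> (\<Sum>c\<in>C. \<Sum>i\<in>UNIV. \<bar>fst c i\<bar>)"
      by (rule member_le_sum) (use that fin in \<open>auto intro: sum_nonneg\<close>)
    finally show ?thesis by (simp add: A_def)
  qed
  show ?thesis
  proof
    show "w0 \<in> F" "\<And>w. w \<in> F \<Longrightarrow> w0 \<tau> \<le> w \<tau>" by (fact w0)+
    \<comment> \<open>Up to this radius the error \<open>A * d\<close> is at most half the spacing
      1/N. The slope is \<open>N * A\<close> because a nonzero coefficient of \<open>\<tau>\<close>
      is at least 1/N in absolute value.\<close>
    show "0 < 1 / (2 * real N * A)" "0 \<le> real N * A" using A1 N(1) by simp_all
    fix w d assume w: "w \<in> S" and d: "0 \<le> d" and w': "\<forall>i\<in>I. w i \<in> \<int>" "\<forall>i\<in>U. \<bar>w i\<bar> \<le> d" "d \<le> 1 / (2 * real N * A)"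
    note w = w w'
    show "w0 \<tau> - real N * A * d \<le> w \<tau>"
    proof -
      define z where "z = (\<lambda>i. if i \<in> J then 0 else w i)"
      have z: "z \<in> S'" "z \<tau> = w \<tau>" using zeroed[OF w(1)] by (auto simp: z_def J_def)
      \<comment> \<open>The two points differ only on \<open>U\<close>, where \<open>bar w\<close>
        is 0.\<close>
      have near: "\<bar>z i - bar w i\<bar> \<le> d" for i
        using w(3) d by (auto simp: z_def bar_def J_def)
      have bd: "rest c (bar w) \<le> rest c z + A * d" if "c \<in> C" for c
      proof -
        have "rest c (bar w) - rest c z = (\<Sum>i\<in>-{\<tau>}. fst c i * (bar w i - z i))"
          by (simp add: rest_def sum_subtractf right_diff_distrib)
        also have "\<dots> \<le> (\<Sum>i\<in>-{\<tau>}. \<bar>fst c i\<bar> * d)"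
        proof (rule sum_mono)
          fix i
          have "fst c i * (bar w i - z i) \<le> \<bar>fst c i * (bar w i - z i)\<bar>" by simp
          also have "\<dots> = \<bar>fst c i\<bar> * \<bar>z i - bar w i\<bar>" by (simp add: abs_mult abs_minus_commute)
          also have "\<dots> \<le> \<bar>fst c i\<bar> * d" by (rule mult_left_mono[OF near]) simp
          finally show "fst c i * (bar w i - z i) \<le> \<bar>fst c i\<bar> * d" .
        qed
        also have "\<dots> \<le> A * d"
          unfolding sum_distrib_right[symmetric] by (rule mult_right_mono[OF A[OF that] d])
        finally show ?thesis by simp
      qed
      have "fst c \<tau> * (w \<tau> + real N * A * d) + rest c (bar w) \<le> snd c" if c: "c \<in> C" for c
      proof (cases "fst c \<tau> = 0")
        case True
        text \<open>Both sides are integer multiples of \<open>1/N\<close>, so a violation by less than \<open>1/N\<close> is none.\<close>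
        have "real N * rest c (bar w) = (\<Sum>i\<in>-{\<tau>}. real N * fst c i * bar w i)"
          by (simp add: rest_def sum_distrib_left mult.assoc)
        also have "\<dots> \<in> \<int>"
          by (intro Ints_sum Ints_mult[OF Na[OF c]] bar_int[OF w(2)]) simp
        finally have int: "real N * rest c (bar w) - real N * snd c \<in> \<int>" using Nb[OF c] by simp
        have "rest c (bar w) \<le> snd c + A * d" using row[OF z(1) c] bd[OF c] True by simp
        also have "\<dots> \<le> snd c + A * (1 / (2 * real N * A))" using w(4) A1 by (intro add_mono mult_left_mono) auto
        also have "\<dots> = snd c + 1 / (2 * real N)" using A1 by simp
        finally have "real N * rest c (bar w) \<le> real N * (snd c + 1 / (2 * real N))"
          by (rule mult_left_mono) simp
        also have "\<dots> = real N * snd c + 1 / 2" using N(1) by (simp add: distrib_left)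
        finally have half: "real N * rest c (bar w) - real N * snd c \<le> 1 / 2" by simp
        obtain k where k: "real N * rest c (bar w) - real N * snd c = of_int k"
          using int by (elim Ints_cases)
        then have "k \<le> 0" using half by linarith
        then have "real N * rest c (bar w) \<le> real N * snd c" using k by simp
        then show ?thesis using True N(1) by simp
      next
        case False
        then have neg: "fst c \<tau> < 0" using nonpos[OF c] by simp
        \<comment> \<open>A negative integer is at most -1, so raising \<open>\<tau>\<close> by
          \<open>N * A * d\<close> gains at least the \<open>A * d\<close> lost in
          \<open>bd\<close>.\<close>
        have "real N * fst c \<tau> \<in> \<int>" "real N * fst c \<tau> < 0"
          using Na[OF c] neg N(1) by (auto simp: mult_pos_neg)
        then have "real N * fst c \<tau> \<le> - 1" by (auto elim!: Ints_cases)
        then have "real N * fst c \<tau> * (A * d) \<le> - 1 * (A * d)"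
          by (rule mult_right_mono) (use A1 d in simp)
        then have "fst c \<tau> * (real N * A * d) \<le> - (A * d)" by (simp add: mult_ac)
        then show ?thesis using row[OF z(1) c] bd[OF c] z(2) by (simp add: distrib_left)
      qed
      then have "(bar w)(\<tau> := w \<tau> + real N * A * d) \<in> S'" unfolding mem_S' by blast
      then obtain w' where "w' \<in> F" "w' \<tau> = w \<tau> + real N * A * d" using lift w(2) by blast
      then show ?thesis using w0(2)[of w'] by simp
    qed
  qed
qed

section \<open>The stochastic program in coordinates\<close>

text \<open>\<open>VU s i\<close> carries the violation \<open>x_s - z\<close> of non-anticipativity and \<open>VT\<close> bounds the objective from
  above, so that the epigraph below is upward closed in \<open>VT\<close>.\<close>

datatype ('nx, 'ny, 's) var = VX 's 'nx | VY 's 'ny | VZ 'nx | VU 's 'nx | VT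

instance var :: (finite, finite, finite) finite
proof
  have eq: "(UNIV :: ('a, 'b, 'c) var set) = range (case_prod VX) \<union> range (case_prod VY) \<union> range VZ \<union>
      range (case_prod VU) \<union> {VT}" (is "_ = ?R")
  proof (rule UNIV_eq_I)
    fix v :: "('a, 'b, 'c) var"
    show "v \<in> ?R" by (cases v) (auto simp: image_iff)
  qed
  show "finite (UNIV :: ('a, 'b, 'c) var set)" unfolding eq by simp
qed

definition feasible_pt ::
  "('nx::finite, 'ny::finite, 's::finite) smip \<Rightarrow> (real^'nx)^'s \<Rightarrow> (real^'ny)^'s \<Rightarrow> bool" where
  "feasible_pt P x y \<longleftrightarrow> (\<forall>s. x $ s \<in> X_set P \<and> y $ s \<in> Y_set P s (x $ s))"

definition obj ::
  "('nx::finite, 'ny::finite, 's::finite) smip \<Rightarrow> (real^'nx)^'s \<Rightarrow> (real^'ny)^'s \<Rightarrow> real" where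
  "obj P x y = (\<Sum>s\<in>UNIV. prob P s * (cost P \<bullet> x $ s + recourse P s \<bullet> y $ s))"

definition xvec :: "(('nx, 'ny, 's) var \<Rightarrow> real) \<Rightarrow> 's \<Rightarrow> real^'nx" where
  "xvec w s = (\<chi> i. w (VX s i))"

definition yvec :: "(('nx, 'ny, 's) var \<Rightarrow> real) \<Rightarrow> 's \<Rightarrow> real^'ny" where
  "yvec w s = (\<chi> j. w (VY s j))"

text \<open>Only the linear constraints enter; integrality is imposed through
  \<open>int_vars\<close>. Equations appear as two inequalities to match half-spaces, and the
  grouping of the conjuncts follows \<open>rat_polyhedron_conj\<close>.\<close>

definition epigraph ::
  "('nx::finite, 'ny::finite, 's::finite) smip \<Rightarrow> (('nx, 'ny, 's) var \<Rightarrow> real) set" where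
  "epigraph P = {w.
     ((\<forall>s. \<forall>k\<in>Xcons P. fst k \<bullet> xvec w s \<le> snd k) \<and>
      (\<forall>s. \<forall>k\<in>Ycons P s. fst k \<bullet> xvec w s + fst (snd k) \<bullet> yvec w s \<le> snd (snd k))) \<and>
     ((\<forall>s i. w (VX s i) - w (VZ i) - w (VU s i) \<le> 0) \<and> (\<forall>s i. w (VZ i) + w (VU s i) - w (VX s i) \<le> 0)) \<and>
     (\<Sum>s\<in>UNIV. prob P s * (cost P \<bullet> xvec w s + recourse P s \<bullet> yvec w s)) - w VT \<le> 0}"

lemma rat_polyhedron_conj:
  "rat_polyhedron {w. p w} \<Longrightarrow> rat_polyhedron {w. q w} \<Longrightarrow> rat_polyhedron {w. p w \<and> q w}"
  using rat_polyhedron_Int[of "{w. p w}" "{w. q w}"] by (simp add: Collect_conj_eq)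

lemma rat_polyhedron_epigraph:
  fixes P :: "('nx::finite, 'ny::finite, 's::finite) smip"
  assumes "smip P" and "rational_data P"
  shows "rat_polyhedron (epigraph P)"
  unfolding epigraph_def
proof (intro rat_polyhedron_conj rat_polyhedron_All)
  have rat: "rational_vec (cost P)" "prob P s \<in> \<rat>" "rational_vec (recourse P s)"
    and ratX: "k \<in> Xcons P \<Longrightarrow> rational_vec (fst k)" "k \<in> Xcons P \<Longrightarrow> snd k \<in> \<rat>"
    and ratY: "k' \<in> Ycons P s \<Longrightarrow> rational_vec (fst k')" "k' \<in> Ycons P s \<Longrightarrow> rational_vec (fst (snd k'))"
      "k' \<in> Ycons P s \<Longrightarrow> snd (snd k') \<in> \<rat>" for s k k'
    using assms(2) unfolding rational_data_def case_prod_beta by blast+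
  have fin: "finite (Xcons P)" "finite (Ycons P s)" for s using assms(1) by (auto simp: smip_def)
  show "rat_polyhedron {w :: ('nx, 'ny, 's) var \<Rightarrow> real. \<forall>k\<in>Xcons P. fst k \<bullet> xvec w s \<le> snd k}" for s
    unfolding xvec_def
    by (intro rat_polyhedron_Ball fin rat_polyhedron_halfspace rat_linear_inner ratX)
  show "rat_polyhedron {w :: ('nx, 'ny, 's) var \<Rightarrow> real.
      \<forall>k\<in>Ycons P s. fst k \<bullet> xvec w s + fst (snd k) \<bullet> yvec w s \<le> snd (snd k)}" for s
    unfolding xvec_def yvec_def
    by (intro rat_polyhedron_Ball fin rat_polyhedron_halfspace rat_linear_add rat_linear_inner ratY)
  show "rat_polyhedron {w :: ('nx, 'ny, 's) var \<Rightarrow> real. w (VX s i) - w (VZ i) - w (VU s i) \<le> 0}" for s i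
    by (intro rat_polyhedron_halfspace rat_linear_diff rat_linear_component) simp
  show "rat_polyhedron {w :: ('nx, 'ny, 's) var \<Rightarrow> real. w (VZ i) + w (VU s i) - w (VX s i) \<le> 0}" for s i
    by (intro rat_polyhedron_halfspace rat_linear_diff rat_linear_add rat_linear_component) simp
  show "rat_polyhedron {w :: ('nx, 'ny, 's) var \<Rightarrow> real.
      (\<Sum>s\<in>UNIV. prob P s * (cost P \<bullet> xvec w s + recourse P s \<bullet> yvec w s)) - w VT \<le> 0}"
    unfolding xvec_def yvec_def
    by (intro rat_polyhedron_halfspace rat_linear_diff rat_linear_sum rat_linear_scale rat_linear_add
        rat_linear_inner rat_linear_component rat) simp_all
qed

section \<open>Translation between feasible points and points of the epigraph\<close>

definition encode ::
  "(real^'nx)^'s \<Rightarrow> (real^'ny)^'s \<Rightarrow> real^'nx \<Rightarrow> real \<Rightarrow> ('nx, 'ny, 's) var \<Rightarrow> real" where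
  "encode x y z t v = (case v of VX s i \<Rightarrow> x $ s $ i | VY s j \<Rightarrow> y $ s $ j | VZ i \<Rightarrow> z $ i
     | VU s i \<Rightarrow> x $ s $ i - z $ i | VT \<Rightarrow> t)"

text \<open>The coordinates \<open>VZ\<close> stay continuous, since z is free in the Lagrangian
  relaxation.\<close>

definition int_vars :: "('nx::finite, 'ny::finite, 's::finite) smip \<Rightarrow> ('nx, 'ny, 's) var set" where
  "int_vars P = {VX s i | s i. i \<in> Xint P} \<union> {VY s j | s j. j \<in> Yint P s}"

lemma encode_simps [simp]:
  "encode x y z t (VX s i) = x $ s $ i" "encode x y z t (VY s j) = y $ s $ j"
  "encode x y z t (VZ i) = z $ i" "encode x y z t (VU s i) = x $ s $ i - z $ i" "encode x y z t VT = t"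
  "xvec (encode x y z t) s = x $ s" "yvec (encode x y z t) s = y $ s"
  by (simp_all add: encode_def xvec_def yvec_def)

lemma feasible_pt_iff:
  "feasible_pt P x y \<longleftrightarrow>
     (\<forall>s. (\<forall>k\<in>Xcons P. fst k \<bullet> x $ s \<le> snd k) \<and> (\<forall>i\<in>Xint P. x $ s $ i \<in> \<int>) \<and>
       (\<forall>k\<in>Ycons P s. fst k \<bullet> x $ s + fst (snd k) \<bullet> y $ s \<le> snd (snd k)) \<and> (\<forall>j\<in>Yint P s. y $ s $ j \<in> \<int>))"
  by (simp add: feasible_pt_def X_set_def X_relax_def Y_set_def Y_relax_def case_prod_beta conj_assoc)

lemma encode_mem_epigraph:
  assumes "feasible_pt P x y"
  shows "encode x y z (obj P x y) \<in> epigraph P" and "\<forall>v\<in>int_vars P. encode x y z (obj P x y) v \<in> \<int>"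
proof -
  note xy = assms[unfolded feasible_pt_iff]
  show "encode x y z (obj P x y) \<in> epigraph P"
    using xy by (simp add: epigraph_def obj_def)
  show "\<forall>v\<in>int_vars P. encode x y z (obj P x y) v \<in> \<int>"
    unfolding int_vars_def using xy by (intro ballI) (elim UnE CollectE exE conjE; simp)
qed

text \<open>Without violation all copies x_s equal z, so one first-stage decision can be read off
  from \<open>VZ\<close>. \<open>VT\<close> may exceed the objective, hence only an
  inequality.\<close>

lemma epigraph_decode:
  fixes P :: "('nx::finite, 'ny::finite, 's::finite) smip"
  assumes w: "w \<in> epigraph P" "\<forall>v\<in>int_vars P. w v \<in> \<int>" and u: "\<And>s i. w (VU s i) = 0"
  shows "feasible_pt P (\<chi> s. \<chi> i. w (VZ i)) (\<chi> s. yvec w s)"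
    and "obj P (\<chi> s. \<chi> i. w (VZ i)) (\<chi> s. yvec w s) \<le> w VT"
proof -
  note ep = w(1)[unfolded epigraph_def mem_Collect_eq]
  have "w (VX s i) \<le> w (VZ i)" "w (VZ i) \<le> w (VX s i)" for s i
  proof -
    have "w (VX s i) - w (VZ i) - w (VU s i) \<le> 0" "w (VZ i) + w (VU s i) - w (VX s i) \<le> 0"
      using ep by blast+
    then show "w (VX s i) \<le> w (VZ i)" "w (VZ i) \<le> w (VX s i)" by (simp_all add: u)
  qed
  then have "w (VZ i) = w (VX s i)" for s i by (rule antisym[rotated])
  then have x: "(\<chi> i. w (VZ i)) = xvec w s" for s unfolding xvec_def by (simp add: vec_eq_iff)
  have "xvec w s $ i \<in> \<int>" if "i \<in> Xint P" for s i
    using w(2) that unfolding xvec_def int_vars_def by simp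
  moreover have "yvec w s $ j \<in> \<int>" if "j \<in> Yint P s" for s j
    using w(2) that unfolding yvec_def int_vars_def by simp
  moreover have "(\<chi> s. \<chi> i. w (VZ i)) $ s = xvec w s" "(\<chi> s. yvec w s) $ s = yvec w s" for s
    by (simp_all add: x)
  ultimately show "feasible_pt P (\<chi> s. \<chi> i. w (VZ i)) (\<chi> s. yvec w s)"
    and "obj P (\<chi> s. \<chi> i. w (VZ i)) (\<chi> s. yvec w s) \<le> w VT"
    using ep unfolding feasible_pt_iff obj_def by simp_all
qed

text \<open>The probabilities sum to 1, so charging the first-stage cost in every scenario with
  weight p_s gives it exactly once.\<close>

lemma SIP_values_eq:
  fixes P :: "('nx::finite, 'ny::finite, 's::finite) smip"
  assumes "smip P"
  shows "SIP_values P = {obj P (\<chi> s. z) y | z y. feasible_pt P (\<chi> s. z) y}"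
proof -
  have "obj P (\<chi> s. z) y = cost P \<bullet> z + (\<Sum>s\<in>UNIV. prob P s * (recourse P s \<bullet> y $ s))" for z y
    using assms by (simp add: obj_def distrib_left sum.distrib sum_distrib_right[symmetric] smip_def)
  then show ?thesis by (auto simp: SIP_values_def feasible_pt_def)
qed

text \<open>This is \<open>mixed_integer_exactness\<close> for the epigraph, with the violation as
  perturbation and \<open>VT\<close> as objective bound; \<open>dec\<close> and \<open>enc\<close>
  identify the unperturbed problem with the stochastic program.\<close>

lemma SIP_exactness:
  fixes P :: "('nx::finite, 'ny::finite, 's::finite) smip"
  assumes "smip P" and "rational_data P"
    and "SIP_values P \<noteq> {}" and below: "\<forall>v\<in>SIP_values P. l \<le> v"
  obtains v \<delta> K where "v \<in> SIP_values P" "\<And>v'. v' \<in> SIP_values P \<Longrightarrow> v \<le> v'" "0 < \<delta>" "0 \<le> K"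
    "\<And>x y z. feasible_pt P x y \<Longrightarrow> norm (\<chi> s. x $ s - z) \<le> \<delta> \<Longrightarrow>
       v - K * norm (\<chi> s. x $ s - z) \<le> obj P x y"
proof -
  define Us :: "('nx, 'ny, 's) var set" where "Us = range (case_prod VU)"
  let ?F = "{w \<in> epigraph P. (\<forall>i\<in>int_vars P. w i \<in> \<int>) \<and> (\<forall>i\<in>Us. w i = 0)}"
  have dec: "\<exists>v\<in>SIP_values P. v \<le> w VT" if "w \<in> ?F" for w
    using that epigraph_decode[of w P] unfolding SIP_values_eq[OF \<open>smip P\<close>] Us_def by fastforce
  have enc: "\<exists>w\<in>?F. w VT = v" if v: "v \<in> SIP_values P" for v
  proof -
    obtain z y where zy: "feasible_pt P (\<chi> s. z) y" "v = obj P (\<chi> s. z) y"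
      using v unfolding SIP_values_eq[OF \<open>smip P\<close>] by blast
    then show ?thesis using encode_mem_epigraph[OF zy(1), of z]
      by (intro bexI[of _ "encode (\<chi> s. z) y z v"]) (auto simp: Us_def)
  qed
  have free: "VT \<notin> int_vars P" "VT \<notin> Us" by (auto simp: int_vars_def Us_def)
  have up: "\<forall>w\<in>epigraph P. \<forall>r\<ge>0. w(VT := w VT + r) \<in> epigraph P"
    by (simp add: epigraph_def xvec_def yvec_def)
  have "?F \<noteq> {}" using enc \<open>SIP_values P \<noteq> {}\<close> by blast
  moreover have "\<forall>w\<in>?F. l \<le> w VT" using dec below by (meson order_trans)
  ultimately obtain w0 \<delta> K where w0: "w0 \<in> ?F" "\<And>w. w \<in> ?F \<Longrightarrow> w0 VT \<le> w VT" "0 < \<delta>" "0 \<le> K"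
    and gap: "\<And>w d. w \<in> epigraph P \<Longrightarrow> 0 \<le> d \<Longrightarrow> \<forall>i\<in>int_vars P. w i \<in> \<int> \<Longrightarrow>
        \<forall>i\<in>Us. \<bar>w i\<bar> \<le> d \<Longrightarrow> d \<le> \<delta> \<Longrightarrow> w0 VT - K * d \<le> w VT"
    by (rule mixed_integer_exactness[OF rat_polyhedron_epigraph[OF assms(1,2)] free up]) blast+
  have le: "w0 VT \<le> v" if "v \<in> SIP_values P" for v using enc[OF that] w0(2) by blast
  show ?thesis
  proof
    \<comment> \<open>\<open>dec\<close> yields a value at most \<open>w0 VT\<close> and
      \<open>le\<close> the reverse inequality, so there is no slack at the minimizer.\<close>
    show "w0 VT \<in> SIP_values P" using dec[OF w0(1)] le by force
    show "w0 VT \<le> v'" if "v' \<in> SIP_values P" for v' using le[OF that] .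
    show "0 < \<delta>" "0 \<le> K" by (fact w0)+
    fix x :: "(real^'nx)^'s" and y z
    assume xy: "feasible_pt P x y" and d: "norm (\<chi> s. x $ s - z) \<le> \<delta>"
    have "\<bar>x $ s $ i - z $ i\<bar> \<le> norm (\<chi> s. x $ s - z)" for s i
      using component_le_norm_cart[of "x $ s - z" i] Finite_Cartesian_Product.norm_nth_le[of "\<chi> s. x $ s - z" s] by simp
    then have "\<forall>v\<in>Us. \<bar>encode x y z (obj P x y) v\<bar> \<le> norm (\<chi> s. x $ s - z)"
      by (auto simp: Us_def)
    from gap[OF encode_mem_epigraph(1)[OF xy] _ encode_mem_epigraph(2)[OF xy] this d]
    show "w0 VT - K * norm (\<chi> s. x $ s - z) \<le> obj P x y" by simp
  qed
qed

section \<open>Exact penalties\<close>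

text \<open>Pair the stationarity conditions with x_s and y_s and use that nonnegative multipliers
  times slacks are nonnegative. The bound is uniform in the violation, which settles large
  violations later.\<close>

lemma LP_weak_duality:
  fixes P :: "('nx::finite, 'ny::finite, 's::finite) smip"
  assumes dual: "LP_dual_feasible P lam mu nu" and xy: "feasible_pt P x y"
  shows "LP_dual_objective P mu nu \<le> obj P x y + lam \<bullet> (\<chi> s. x $ s - z)"
proof -
  define \<beta> where "\<beta> s = (\<Sum>(a, b)\<in>Xcons P. mu s (a, b) * b) + (\<Sum>(d, e, f)\<in>Ycons P s. nu s (d, e, f) * f)" for s
  have row: "- \<beta> s \<le> prob P s * (cost P \<bullet> x $ s + recourse P s \<bullet> y $ s) + lam $ s \<bullet> x $ s" for s
  proof -
    have "(prob P s *\<^sub>R cost P + lam $ s + (\<Sum>(a, b) \<in> Xcons P. mu s (a, b) *\<^sub>R a)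
            + (\<Sum>(d, e, f) \<in> Ycons P s. nu s (d, e, f) *\<^sub>R d)) \<bullet> x $ s = 0"
      "(prob P s *\<^sub>R recourse P s + (\<Sum>(d, e, f) \<in> Ycons P s. nu s (d, e, f) *\<^sub>R e)) \<bullet> y $ s = 0"
      using dual by (simp_all add: LP_dual_feasible_def)
    then have eqs: "prob P s * (cost P \<bullet> x $ s) + lam $ s \<bullet> x $ s
          + (\<Sum>k\<in>Xcons P. mu s k * (fst k \<bullet> x $ s)) + (\<Sum>k\<in>Ycons P s. nu s k * (fst k \<bullet> x $ s)) = 0"
      "prob P s * (recourse P s \<bullet> y $ s) + (\<Sum>k\<in>Ycons P s. nu s k * (fst (snd k) \<bullet> y $ s)) = 0"
      by (simp_all add: inner_add_left inner_sum_left case_prod_beta)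
    have nonneg: "\<forall>k\<in>Xcons P. 0 \<le> mu s k" "\<forall>k\<in>Ycons P s. 0 \<le> nu s k"
      using dual by (simp_all add: LP_dual_feasible_def)
    have "(\<Sum>k\<in>Xcons P. mu s k * (fst k \<bullet> x $ s)) \<le> (\<Sum>k\<in>Xcons P. mu s k * snd k)"
      by (intro sum_mono mult_left_mono) (use nonneg xy in \<open>unfold feasible_pt_iff, blast+\<close>)
    moreover have "(\<Sum>k\<in>Ycons P s. nu s k * (fst k \<bullet> x $ s + fst (snd k) \<bullet> y $ s))
        \<le> (\<Sum>k\<in>Ycons P s. nu s k * snd (snd k))"
      by (intro sum_mono mult_left_mono) (use nonneg xy in \<open>unfold feasible_pt_iff, blast+\<close>)
    ultimately show ?thesis
      using eqs by (simp add: \<beta>_def case_prod_beta distrib_left sum.distrib)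
  qed
  \<comment> \<open>Stationarity in z makes the multipliers sum to zero, so the free z drops
    out.\<close>
  have "(\<Sum>s\<in>UNIV. lam $ s \<bullet> z) = 0"
    using dual by (simp add: LP_dual_feasible_def inner_sum_left[symmetric])
  then have "lam \<bullet> (\<chi> s. x $ s - z) = (\<Sum>s\<in>UNIV. lam $ s \<bullet> x $ s)"
    by (simp add: inner_vec_def[of lam] inner_diff_right sum_subtractf)
  moreover have "LP_dual_objective P mu nu = (\<Sum>s\<in>UNIV. - \<beta> s)"
    unfolding LP_dual_objective_def \<beta>_def sum_negf ..
  ultimately show ?thesis
    using sum_mono[of UNIV "\<lambda>s. - \<beta> s", OF row] by (simp add: obj_def sum.distrib)
qed

text \<open>Moving the weights p_s into the multiplier leaves a single inner product with the
  violation; for \<open>omega_LP\<close> the weighted multiplier is again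
  \<open>lam\<close>.\<close>

lemma LR_values_eq:
  fixes P :: "('nx::finite, 'ny::finite, 's::finite) smip"
  shows "LR_values P \<psi> \<omega> = {obj P x y + (\<chi> s. prob P s *\<^sub>R \<omega> $ s) \<bullet> (\<chi> s. x $ s - z) + \<psi> (\<chi> s. x $ s - z) | x y z.
     feasible_pt P x y}"
proof -
  have "(\<Sum>s\<in>UNIV. prob P s * L_fun P s (x $ s) (y $ s) z \<omega>) =
      obj P x y + (\<chi> s. prob P s *\<^sub>R \<omega> $ s) \<bullet> (\<chi> s. x $ s - z)" for x y z
    by (simp add: L_fun_def obj_def inner_vec_def[of "\<chi> s. _ s"] distrib_left sum.distrib)
  then show ?thesis by (simp add: LR_values_def feasible_pt_def)
qed

lemma weighted_omega_LP:
  assumes "smip P"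
  shows "(\<chi> s. prob P s *\<^sub>R omega_LP P lam $ s) = lam"
proof -
  have "prob P s \<noteq> 0" for s using assms by (auto simp: smip_def less_imp_neq[symmetric])
  then show ?thesis by (simp add: omega_LP_def vec_eq_iff)
qed

lemma Lagrangian_lower_bound:
  fixes P :: "('nx::finite, 'ny::finite, 's::finite) smip"
  assumes "smip P" and "rational_data P"
    and "SIP_values P \<noteq> {}" and "\<forall>v\<in>SIP_values P. l \<le> v"
    and dual: "LP_dual_feasible P lam mu nu"
  obtains v R where "v \<in> SIP_values P" "\<And>v'. v' \<in> SIP_values P \<Longrightarrow> v \<le> v'" "0 < R"
    "\<And>x y z. feasible_pt P x y \<Longrightarrow>
       v - R * norm (\<chi> s. x $ s - z) \<le> obj P x y + lam \<bullet> (\<chi> s. x $ s - z)"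
proof -
  obtain v \<delta> K where v: "v \<in> SIP_values P" "\<And>v'. v' \<in> SIP_values P \<Longrightarrow> v \<le> v'" and "0 < \<delta>" "0 \<le> K"
    and small: "\<And>x y z. feasible_pt P x y \<Longrightarrow> norm (\<chi> s. x $ s - z) \<le> \<delta> \<Longrightarrow>
       v - K * norm (\<chi> s. x $ s - z) \<le> obj P x y"
    by (rule SIP_exactness[OF assms(1-4)]) blast+
  define D where "D = LP_dual_objective P mu nu"
  \<comment> \<open>For violations up to \<open>\<delta>\<close>, \<open>K + norm lam\<close>
    absorbs both the perturbation loss and the multiplier term. Beyond \<open>\<delta>\<close>, the
    quotient makes \<open>R * norm u\<close> cover the gap between \<open>v\<close> and the dual
    bound \<open>D\<close>. The 1 ensures positivity.\<close>
  define R where "R = max 1 (max (K + norm lam) ((v - D) / \<delta>))"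
  show ?thesis
  proof
    show "v \<in> SIP_values P" "\<And>v'. v' \<in> SIP_values P \<Longrightarrow> v \<le> v'" by (fact v)+
    show "0 < R" by (simp add: R_def)
    fix x :: "(real^'nx)^'s" and y z
    assume xy: "feasible_pt P x y"
    define u where "u = (\<chi> s. x $ s - z)"
    have "v - R * norm u \<le> obj P x y + lam \<bullet> u"
    proof (cases "norm u \<le> \<delta>")
      case True
      have "(K + norm lam) * norm u \<le> R * norm u" by (rule mult_right_mono) (auto simp: R_def)
      moreover have "v - K * norm u \<le> obj P x y" using small[OF xy] True by (simp add: u_def)
      moreover have "- (norm lam * norm u) \<le> lam \<bullet> u" using Cauchy_Schwarz_ineq2[of lam u] by linarith
      ultimately show ?thesis by (simp add: distrib_right)
    next
      case False
      have "v - D \<le> R * \<delta>" using \<open>0 < \<delta>\<close> by (simp add: R_def pos_divide_le_eq[symmetric])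
      also have "\<dots> \<le> R * norm u" using False by (intro mult_left_mono) (auto simp: R_def)
      finally show ?thesis using LP_weak_duality[OF dual xy, of z] by (simp add: D_def u_def)
    qed
    then show "v - R * norm (\<chi> s. x $ s - z) \<le> obj P x y + lam \<bullet> (\<chi> s. x $ s - z)" by (simp add: u_def)
  qed
qed

lemma ereal_INF_attained:
  fixes A :: "real set"
  assumes "v \<in> A" "\<And>v'. v' \<in> A \<Longrightarrow> v \<le> v'"
  shows "(INF v\<in>A. ereal v) = ereal v"
  using assms by (intro antisym INF_lower INF_greatest) auto

text \<open>A sandwich: an optimal non-anticipative point has no violation and no penalty, so
  \<open>v\<close> bounds the relaxation from above for every multiplier. At \<open>omega_LP\<close>
  the penalty compensates the loss \<open>R * norm u\<close>, so \<open>v\<close> is also a lower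
  bound.\<close>

lemma exact_penalty:
  fixes P :: "('nx::finite, 'ny::finite, 's::finite) smip"
  assumes "smip P"
    and v: "v \<in> SIP_values P" "\<And>v'. v' \<in> SIP_values P \<Longrightarrow> v \<le> v'"
    and bound: "\<And>x y z. feasible_pt P x y \<Longrightarrow>
       v - R * norm (\<chi> s. x $ s - z) \<le> obj P x y + lam \<bullet> (\<chi> s. x $ s - z)"
    and \<omega>: "omega_LP P lam \<in> Omega P"
    and \<psi>: "\<psi> 0 = 0" "\<And>u. R * norm u \<le> \<psi> u"
  shows "zeta_LD P \<psi> = zeta_LR P \<psi> (omega_LP P lam) \<and>
    zeta_LR P \<psi> (omega_LP P lam) = zeta_SIP P \<and>
    zeta_LR P \<psi> (omega_LP P lam) \<in> ereal ` LR_values P \<psi> (omega_LP P lam)"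
proof -
  obtain z y where zy: "feasible_pt P (\<chi> s. z) y" "v = obj P (\<chi> s. z) y"
    using v(1) unfolding SIP_values_eq[OF \<open>smip P\<close>] by blast
  have mem: "v \<in> LR_values P \<psi> \<omega>" for \<omega>
  proof -
    have "(\<chi> s. (\<chi> s. z) $ s - z) = (0 :: (real^'nx)^'s)" by (simp add: vec_eq_iff)
    then show ?thesis
      unfolding LR_values_eq mem_Collect_eq
      by (intro exI[of _ "\<chi> s. z"] exI[of _ y] exI[of _ z]) (simp add: zy \<psi>)
  qed
  have "v \<le> v'" if "v' \<in> LR_values P \<psi> (omega_LP P lam)" for v'
  proof -
    obtain x y z where xy: "feasible_pt P x y"
      "v' = obj P x y + lam \<bullet> (\<chi> s. x $ s - z) + \<psi> (\<chi> s. x $ s - z)"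
      using \<open>v' \<in> _\<close> unfolding LR_values_eq weighted_omega_LP[OF \<open>smip P\<close>] by blast
    then show ?thesis using bound[OF xy(1), of z] \<psi>(2)[of "\<chi> s. x $ s - z"] by simp
  qed
  then have LR: "zeta_LR P \<psi> (omega_LP P lam) = ereal v"
    unfolding zeta_LR_def by (intro ereal_INF_attained mem)
  have "zeta_LR P \<psi> \<omega> \<le> ereal v" for \<omega>
    unfolding zeta_LR_def by (intro INF_lower mem)
  then have "zeta_LD P \<psi> = ereal v"
    unfolding zeta_LD_def using LR \<omega> by (intro antisym SUP_least) (auto intro: SUP_upper2)
  moreover have "zeta_SIP P = ereal v"
    unfolding zeta_SIP_def using v by (rule ereal_INF_attained)
  ultimately show ?thesis using LR mem by auto
qed

section \<open>Norm bounds for the augmenting functions\<close>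

lemma psi_inf_zero: "N \<noteq> {} \<Longrightarrow> psi_inf N 0 = 0"
  by (simp add: psi_inf_def image_constant_conv)

text \<open>Writing a vector e as a nonnegative combination of \<open>N\<close> bounds the inner
  product of e and u by a multiple of \<open>psi_inf N u\<close>. Taking plus and minus each
  coordinate vector for e bounds all coordinates of u.\<close>

lemma psi_inf_ge_norm:
  fixes N :: "'a::euclidean_space set"
  assumes "positive_basis N"
  obtains A where "A > 0" "\<And>u. norm u \<le> A * psi_inf N u"
proof -
  have fin: "finite N" using assms by (simp add: positive_basis_def)
  have span: "\<exists>\<alpha>. (\<forall>n\<in>N. 0 \<le> \<alpha> n) \<and> u = (\<Sum>n\<in>N. \<alpha> n *\<^sub>R n)" for u
    using assms by (simp add: positive_basis_def)
  then obtain \<alpha> where \<alpha>: "\<And>u n. n \<in> N \<Longrightarrow> 0 \<le> \<alpha> u n" and rep: "\<And>u. u = (\<Sum>n\<in>N. \<alpha> u n *\<^sub>R n)"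
    by metis
  define S where "S e = (\<Sum>n\<in>N. \<alpha> e n)" for e
  have S: "0 \<le> S e" for e unfolding S_def by (rule sum_nonneg) (rule \<alpha>)
  have le: "e \<bullet> u \<le> S e * psi_inf N u" for e u
  proof -
    have "e \<bullet> u = (\<Sum>n\<in>N. \<alpha> e n * (n \<bullet> u))" by (subst rep) (simp add: inner_sum_left)
    also have "\<dots> \<le> (\<Sum>n\<in>N. \<alpha> e n * psi_inf N u)"
      unfolding psi_inf_def using fin by (intro sum_mono mult_left_mono \<alpha> Max_ge) auto
    finally show ?thesis by (simp add: S_def sum_distrib_right)
  qed
  \<comment> \<open>For nonzero \<open>u\<close>, taking e = u makes the left side of
    \<open>le\<close> positive, while the factor \<open>S u\<close> is nonnegative.\<close>
  have nonneg: "0 \<le> psi_inf N u" for u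
  proof (cases "u = 0")
    case True
    have "N \<noteq> {}" using assms by (auto simp: positive_basis_def)
    then show ?thesis using True by (simp add: psi_inf_zero)
  next
    case False
    then have "0 < S u * psi_inf N u" using le[of u u] inner_gt_zero_iff[of u] by linarith
    then show ?thesis using S[of u] by (simp add: zero_less_mult_iff)
  qed
  define A where "A = 1 + (\<Sum>b\<in>Basis. S b + S (- b))"
  show ?thesis
  proof
    show "A > 0" unfolding A_def by (intro add_pos_nonneg sum_nonneg add_nonneg_nonneg S) simp
    fix u :: 'a
    have "norm u \<le> (\<Sum>b\<in>Basis. \<bar>u \<bullet> b\<bar>)" by (rule norm_le_l1)
    also have "\<dots> \<le> (\<Sum>b\<in>Basis. (S b + S (- b)) * psi_inf N u)"
    proof (rule sum_mono)
      fix b :: 'a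
      have "0 \<le> S b * psi_inf N u" "0 \<le> S (- b) * psi_inf N u" using S nonneg by simp_all
      then show "\<bar>u \<bullet> b\<bar> \<le> (S b + S (- b)) * psi_inf N u"
        using le[of b u] le[of "- b" u] by (simp add: distrib_right inner_commute abs_le_iff)
    qed
    also have "\<dots> \<le> A * psi_inf N u" using nonneg[of u] by (simp add: A_def distrib_right sum_distrib_right)
    finally show "norm u \<le> A * psi_inf N u" .
  qed
qed

text \<open>This carries the norm bound for \<open>psi_inf\<close> over to
  \<open>psi_one\<close>.\<close>

lemma psi_inf_le_psi_one:
  fixes N :: "'a::euclidean_space set"
  assumes "finite N" "N \<noteq> {}"
  shows "psi_inf N u \<le> psi_one N u"
  unfolding psi_inf_def
proof (subst Max_le_iff)
  have "n \<bullet> u \<le> psi_one N u" if "n \<in> N" for n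
  proof -
    have "n \<bullet> u \<le> max (n \<bullet> u) 0" by simp
    also have "\<dots> \<le> psi_one N u"
      unfolding psi_one_def by (rule member_le_sum[of _ _ "\<lambda>n. max (n \<bullet> u) 0"]) (use assms that in auto)
    finally show ?thesis .
  qed
  then show "\<forall>t\<in>(\<lambda>n. n \<bullet> u) ` N. t \<le> psi_one N u" by blast
qed (use assms in auto)

text \<open>The negative parts of v and -v add up to the absolute value, so with all parameters
  equal to \<open>R\<close> the penalty is R times the l1 norm.\<close>

lemma asym_penalty_ge_norm:
  fixes u :: "(real^'nx::finite)^'s::finite"
  assumes "0 \<le> R"
  shows "R * norm u \<le> asym_penalty (\<chi> s i. R) (\<chi> s i. R) u"
proof -
  have "asym_penalty (\<chi> s i. R) (\<chi> s i. R) u = (\<Sum>s\<in>UNIV. \<Sum>i\<in>UNIV. R * \<bar>u $ s $ i\<bar>)"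
    unfolding asym_penalty_def inner_vec_def neg_part_def sum.distrib[symmetric]
    by (intro sum.cong) (auto simp: min_def abs_if)
  moreover have "norm u \<le> (\<Sum>s\<in>UNIV. \<Sum>i\<in>UNIV. \<bar>u $ s $ i\<bar>)"
  proof -
    have "norm u \<le> (\<Sum>s\<in>UNIV. norm (u $ s))"
      unfolding norm_vec_def by (rule L2_set_le_sum) simp
    also have "\<dots> \<le> (\<Sum>s\<in>UNIV. \<Sum>i\<in>UNIV. \<bar>u $ s $ i\<bar>)" by (intro sum_mono norm_le_l1_cart)
    finally show ?thesis .
  qed
  ultimately show ?thesis
    using mult_left_mono[OF _ assms] by (simp add: sum_distrib_left[symmetric])
qed

theorem corollary8:
  fixes P :: "('nx::finite, 'ny::finite, 's::finite) smip"
    and lam :: "(real^'nx)^'s"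
  assumes "smip P"
    and "rational_data P"
    and feasible: "SIP_values P \<noteq> {}"
    and finite_value: "\<bar>zeta_SIP P\<bar> \<noteq> \<infinity>"
    and "optimal_LP_multiplier P lam"
  shows "zeta_SIP P \<in> ereal ` SIP_values P \<and>
    omega_LP P lam \<in> Omega P \<and>
    (\<forall>(N :: ((real^'nx)^'s) set) \<psi>.
       positive_basis N \<and> (\<psi> = psi_inf N \<or> \<psi> = psi_one N) \<longrightarrow>
       (\<exists>\<rho>>0.
          zeta_LD P (\<lambda>u. \<rho> * \<psi> u) = zeta_LR P (\<lambda>u. \<rho> * \<psi> u) (omega_LP P lam) \<and>
          zeta_LR P (\<lambda>u. \<rho> * \<psi> u) (omega_LP P lam) = zeta_SIP P \<and>
          zeta_LR P (\<lambda>u. \<rho> * \<psi> u) (omega_LP P lam) \<in> ereal `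
            LR_values P (\<lambda>u. \<rho> * \<psi> u) (omega_LP P lam))) \<and>
    (\<exists>\<rho>l \<rho>u :: (real^'nx)^'s.
       (\<forall>s i. 0 < \<rho>l $ s $ i \<and> 0 < \<rho>u $ s $ i) \<and>
       zeta_LD P (asym_penalty \<rho>l \<rho>u) = zeta_LR P (asym_penalty \<rho>l \<rho>u) (omega_LP P lam) \<and>
       zeta_LR P (asym_penalty \<rho>l \<rho>u) (omega_LP P lam) = zeta_SIP P \<and>
       zeta_LR P (asym_penalty \<rho>l \<rho>u) (omega_LP P lam) \<in> ereal `
         LR_values P (asym_penalty \<rho>l \<rho>u) (omega_LP P lam))"
proof (intro conjI allI impI)
  obtain mu nu where dual: "LP_dual_feasible P lam mu nu"
    using \<open>optimal_LP_multiplier P lam\<close> by (auto simp: optimal_LP_multiplier_def)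
  obtain l where l: "zeta_SIP P = ereal l" using finite_value by auto
  have "\<forall>v\<in>SIP_values P. l \<le> v"
    using INF_lower[of _ "SIP_values P" ereal] l by (auto simp: zeta_SIP_def)
  then obtain v R where v: "v \<in> SIP_values P" "\<And>v'. v' \<in> SIP_values P \<Longrightarrow> v \<le> v'" and "0 < R"
    and bound: "\<And>x y z. feasible_pt P x y \<Longrightarrow>
       v - R * norm (\<chi> s. x $ s - z) \<le> obj P x y + lam \<bullet> (\<chi> s. x $ s - z)"
    using Lagrangian_lower_bound[OF assms(1,2) feasible _ dual] by blast
  show "zeta_SIP P \<in> ereal ` SIP_values P"
    using ereal_INF_attained[OF v] v(1) by (simp add: zeta_SIP_def)
  \<comment> \<open>Weighting by p_s cancels the division in \<open>omega_LP\<close>, and dual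
    feasibility makes the \<open>lam $ s\<close> sum to zero.\<close>
  have "(\<Sum>s\<in>UNIV. prob P s *\<^sub>R omega_LP P lam $ s) = (\<Sum>s\<in>UNIV. lam $ s)"
    using weighted_omega_LP[OF \<open>smip P\<close>, of lam] by (simp add: vec_eq_iff)
  then show \<omega>: "omega_LP P lam \<in> Omega P"
    using dual by (simp add: Omega_def LP_dual_feasible_def)
  note exact = exact_penalty[OF \<open>smip P\<close> v bound \<omega>]

  show "\<exists>\<rho>>0.
      zeta_LD P (\<lambda>u. \<rho> * \<psi> u) = zeta_LR P (\<lambda>u. \<rho> * \<psi> u) (omega_LP P lam) \<and>
      zeta_LR P (\<lambda>u. \<rho> * \<psi> u) (omega_LP P lam) = zeta_SIP P \<and>
      zeta_LR P (\<lambda>u. \<rho> * \<psi> u) (omega_LP P lam) \<in> ereal `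
        LR_values P (\<lambda>u. \<rho> * \<psi> u) (omega_LP P lam)"
    if N\<psi>: "positive_basis N \<and> (\<psi> = psi_inf N \<or> \<psi> = psi_one N)" for N :: "((real^'nx)^'s) set" and \<psi>
  proof -
    have N: "finite N" "N \<noteq> {}" using that by (auto simp: positive_basis_def)
    obtain A where A: "A > 0" "\<And>u. norm u \<le> A * psi_inf N u"
      using psi_inf_ge_norm N\<psi> by blast
    have "norm u \<le> A * \<psi> u" for u
    proof -
      have "psi_inf N u \<le> \<psi> u" using that psi_inf_le_psi_one[OF N] by auto
      then have "A * psi_inf N u \<le> A * \<psi> u" using A(1) by simp
      then show ?thesis using A(2)[of u] by simp
    qed
    then have "R * norm u \<le> R * A * \<psi> u" for u
      using mult_left_mono[of "norm u" "A * \<psi> u" R] \<open>0 < R\<close> by (simp add: mult.assoc)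
    moreover have "R * A * \<psi> 0 = 0" using N\<psi> psi_inf_zero[OF N(2)] by (auto simp: psi_one_def)
    \<comment> \<open>The penalty parameter is \<open>R * A\<close>: \<open>A\<close> turns the
      augmenting function into a bound for the norm, and \<open>R\<close> is the slope to be
      compensated.\<close>
    moreover have "0 < R * A" using \<open>0 < R\<close> A(1) by simp
    ultimately show ?thesis
      using exact[of "\<lambda>u. R * A * \<psi> u"] by blast
  qed

  define \<rho> :: "(real^'nx)^'s" where "\<rho> = (\<chi> s i. R)"
  have "asym_penalty \<rho> \<rho> 0 = 0"
    by (simp add: asym_penalty_def neg_part_def inner_vec_def)
  moreover have "R * norm u \<le> asym_penalty \<rho> \<rho> u" for u
    unfolding \<rho>_def using \<open>0 < R\<close> by (intro asym_penalty_ge_norm) simp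
  moreover have "\<forall>s i. 0 < \<rho> $ s $ i \<and> 0 < \<rho> $ s $ i" using \<open>0 < R\<close> by (simp add: \<rho>_def)
  ultimately show "\<exists>\<rho>l \<rho>u :: (real^'nx)^'s.
       (\<forall>s i. 0 < \<rho>l $ s $ i \<and> 0 < \<rho>u $ s $ i) \<and>
       zeta_LD P (asym_penalty \<rho>l \<rho>u) = zeta_LR P (asym_penalty \<rho>l \<rho>u) (omega_LP P lam) \<and>
       zeta_LR P (asym_penalty \<rho>l \<rho>u) (omega_LP P lam) = zeta_SIP P \<and>
       zeta_LR P (asym_penalty \<rho>l \<rho>u) (omega_LP P lam) \<in> ereal `
         LR_values P (asym_penalty \<rho>l \<rho>u) (omega_LP P lam)"
    using exact[of "asym_penalty \<rho> \<rho>"] by blast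
qed

end
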